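(* Fix a level $c$ of $C$. Assume that for all $a,a^*\in\{0,1\}$ and all $m$, $$Y_{am}\perp A\mid (C,U),\quad Y_{am}\perp M\mid (A,C,U),\quad M_a\perp A\mid (C,U),\quad Y_{am}\perp M_{a^*}\mid (C,U),$$ and that $A\perp U\mid C$. Then the true conditional natural direct effect on the risk ratio scale satisfies $$\mathrm{NDE}^{\mathrm{true}}_{\mathrm{RR}|c}\;\ge\;\mathrm{NDE}^{\mathrm{obs}}_{\mathrm{RR}|c}\big/\mathrm{BF}_{U|(M,c)},$$ and this bound is sharp, i.e. attainable: for all finite $\gamma,\delta\ge 1$ there is a joint distribution satisfying all the assumptions, with $\mathrm{RR}_{AU|(M,c)}=\gamma$ and $\mathrm{RR}_{UY|(A=1,M,c)}=\delta$, for which equality holds.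
   Context: Setting. $A\in\{0,1\}$ is a binary exposure, $Y\in\{0,1\}$ a binary outcome, $M$ a categorical mediator, $C$ categorical observed baseline covariates and $U$ categorical unmeasured baseline covariates ($M$, $C$, $U$ take finitely many values; they may be vectors). $Y_a$ and $M_a$ are the potential outcome and potential mediator under exposure $a$; $Y_{am}$ is the potential outcome under exposure $a$ and mediator value $m$; $Y_{aM_{a^*}}$ is the potential outcome under exposure $a$ with the mediator set to $M_{a^*}$. Consistency: $Y_a=Y$ and $M_a=M$ if $A=a$; $Y_{am}=Y$ if $A=a$ and $M=m$. Composition: $Y_{aM_a}=Y_a$ for $a=0,1$. The symbol $\perp$ denotes (conditional) independence; lower-case $m,c,u$ in conditional probabilities stand for the events $M=m$, $C=c$, $U=u$. Effects. $\mathrm{NDE}^{\mathrm{true}}_{\mathrm{RR}|c}=\dfrac{P(Y_{1M_0}=1\mid c)}{P(Y_{0M_0}=1\mid c)}$ and $\mathrm{NDE}^{\mathrm{obs}}_{\mathrm{RR}|c}=\dfrac{\sum_m P(Y=1\mid A=1,m,c)P(m\mid A=0,c)}{\sum_m P(Y=1\mid A=0,m,c)P(m\mid A=0,c)}$. Sensitivity parameters. $$\mathrm{RR}_{UY|(A=1,M,c)}=\max_m\frac{\max_u P(Y=1\mid A=1,m,c,u)}{\min_u P(Y=1\mid A=1,m,c,u)},\qquad \mathrm{RR}_{AU|(M,c)}=\max_m\max_u\frac{P(u\mid A=1,m,c)}{P(u\mid A=0,m,c)}.$$ Bounding factor: $$\mathrm{BF}_{U|(M,c)}=\frac{\mathrm{RR}_{AU|(M,c)}\times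 \mathrm{RR}_{UY|(A=1,M,c)}}{\mathrm{RR}_{AU|(M,c)}+\mathrm{RR}_{UY|(A=1,M,c)}-1}.$$ Conventions. $P(C=c)>0$, $P(A=a\mid c)>0$ for $a=0,1$, and $P(m\mid A=1,c)>0$ whenever $P(m\mid A=0,c)>0$; denominators in the effects are positive. Maxima over $m$ are over $m$ with $P(m\mid A=0,c)>0$; $u$ ranges over values with $P(u\mid c)>0$. $P(Y=1\mid A=a,m,c,u)$ is understood as $P(Y_{am}=1\mid c,u)$ (with which it coincides under the independence assumptions) when its conditioning event has probability zero. A positive number over $0$ is $+\infty$; ratios $0/0$ are omitted from the maximum defining $\mathrm{RR}_{AU|(M,c)}$ and are read as $1$ in $\mathrm{RR}_{UY|(A=1,M,c)}$. If exactly one sensitivity parameter is infinite, $\mathrm{BF}_{U|(M,c)}$ equals the other; if both are, $\mathrm{BF}_{U|(M,c)}=\infty$ and $x/\infty=0$. *)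

theory Defs
  imports "HOL-Probability.Probability"
begin

(* For exposures and outcomes (type bool), True stands for 1 and False for 0.
   The type parameters 'm, 'c, 'u are the value types of the mediator, the observed
   and the unmeasured covariates; they may be infinite, but see mediation_model below. *)

record ('w, 'm, 'c, 'u) mediation =
  law :: "'w measure"
  exposure :: "'w \<Rightarrow> bool"                        (* A *)
  outcome :: "'w \<Rightarrow> bool"                         (* Y *)
  mediator :: "'w \<Rightarrow> 'm"                          (* M *)
  covariate :: "'w \<Rightarrow> 'c"                         (* C *)
  confounder :: "'w \<Rightarrow> 'u"                        (* U *)
  pot_outcome :: "bool \<Rightarrow> 'w \<Rightarrow> bool"             (* Y_a *)
  pot_mediator :: "bool \<Rightarrow> 'w \<Rightarrow> 'm"              (* M_a *)
  joint_pot_outcome :: "bool \<Rightarrow> 'm \<Rightarrow> 'w \<Rightarrow> bool" (* Y_am *)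

(* Y_{a M_{a'}} *)
definition nested_outcome ::
    "('w, 'm, 'c, 'u) mediation \<Rightarrow> bool \<Rightarrow> bool \<Rightarrow> 'w \<Rightarrow> bool" where
  "nested_outcome S a a' \<omega> = joint_pot_outcome S a (pot_mediator S a' \<omega>) \<omega>"

(* A categorical variable is a random variable with finitely many values, i.e. a
   simple function. *)
definition mediation_model :: "('w, 'm, 'c, 'u) mediation \<Rightarrow> bool" where
  "mediation_model S \<longleftrightarrow>
     prob_space (law S) \<and>
     simple_function (law S) (exposure S) \<and>
     simple_function (law S) (outcome S) \<and>
     simple_function (law S) (mediator S) \<and>
     simple_function (law S) (covariate S) \<and>
     simple_function (law S) (confounder S) \<and>
     (\<forall>a. simple_function (law S) (pot_outcome S a)) \<and>
     (\<forall>a. simple_function (law S) (pot_mediator S a)) \<and>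
     (\<forall>a m. simple_function (law S) (joint_pot_outcome S a m)) \<and>
     \<comment> \<open>consistency\<close>
     (\<forall>\<omega>\<in>space (law S). \<forall>a. exposure S \<omega> = a \<longrightarrow>
        pot_outcome S a \<omega> = outcome S \<omega> \<and> pot_mediator S a \<omega> = mediator S \<omega>) \<and>
     (\<forall>\<omega>\<in>space (law S). \<forall>a m. exposure S \<omega> = a \<and> mediator S \<omega> = m \<longrightarrow>
        joint_pot_outcome S a m \<omega> = outcome S \<omega>) \<and>
     \<comment> \<open>composition\<close>
     (\<forall>\<omega>\<in>space (law S). \<forall>a. nested_outcome S a a \<omega> = pot_outcome S a \<omega>)"

(* Conditional independence of finitely-valued X and Z given finitely-valued W:
   events of the form X = x, Z = z, W = w suffice. *)
definition cond_indep ::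
    "'w measure \<Rightarrow> ('w \<Rightarrow> 'x) \<Rightarrow> ('w \<Rightarrow> 'z) \<Rightarrow> ('w \<Rightarrow> 'v) \<Rightarrow> bool" where
  "cond_indep P X Z W \<longleftrightarrow>
     (\<forall>x z w. \<P>(\<omega> in P. W \<omega> = w) > 0 \<longrightarrow>
        \<P>(\<omega> in P. X \<omega> = x \<and> Z \<omega> = z \<bar> W \<omega> = w) =
        \<P>(\<omega> in P. X \<omega> = x \<bar> W \<omega> = w) * \<P>(\<omega> in P. Z \<omega> = z \<bar> W \<omega> = w))"

definition independence_assumptions :: "('w, 'm, 'c, 'u) mediation \<Rightarrow> bool" where
  "independence_assumptions S \<longleftrightarrow>
     (\<forall>a a' m.
        cond_indep (law S) (joint_pot_outcome S a m) (exposure S)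
          (\<lambda>\<omega>. (covariate S \<omega>, confounder S \<omega>)) \<and>
        cond_indep (law S) (joint_pot_outcome S a m) (mediator S)
          (\<lambda>\<omega>. (exposure S \<omega>, covariate S \<omega>, confounder S \<omega>)) \<and>
        cond_indep (law S) (pot_mediator S a) (exposure S)
          (\<lambda>\<omega>. (covariate S \<omega>, confounder S \<omega>)) \<and>
        cond_indep (law S) (joint_pot_outcome S a m) (pot_mediator S a')
          (\<lambda>\<omega>. (covariate S \<omega>, confounder S \<omega>))) \<and>
     cond_indep (law S) (exposure S) (confounder S) (covariate S)"

(* P(m | A = a, c) *)
definition mediator_prob ::
    "('w, 'm, 'c, 'u) mediation \<Rightarrow> 'c \<Rightarrow> bool \<Rightarrow> 'm \<Rightarrow> real" where
  "mediator_prob S c a m =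
     \<P>(\<omega> in law S. mediator S \<omega> = m \<bar> exposure S \<omega> = a \<and> covariate S \<omega> = c)"

(* P(Y_{a M_{a'}} = 1 | c) *)
definition nested_risk ::
    "('w, 'm, 'c, 'u) mediation \<Rightarrow> 'c \<Rightarrow> bool \<Rightarrow> bool \<Rightarrow> real" where
  "nested_risk S c a a' = \<P>(\<omega> in law S. nested_outcome S a a' \<omega> \<bar> covariate S \<omega> = c)"

(* sum over m of P(Y = 1 | A = a, m, c) P(m | A = a', c) *)
definition standardized_risk ::
    "('w, 'm, 'c, 'u) mediation \<Rightarrow> 'c \<Rightarrow> bool \<Rightarrow> bool \<Rightarrow> real" where
  "standardized_risk S c a a' =
     (\<Sum>m \<in> mediator S ` space (law S).
        \<P>(\<omega> in law S. outcome S \<omega> \<bar>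
            exposure S \<omega> = a \<and> mediator S \<omega> = m \<and> covariate S \<omega> = c)
        * mediator_prob S c a' m)"

definition NDE_true :: "('w, 'm, 'c, 'u) mediation \<Rightarrow> 'c \<Rightarrow> real" where
  "NDE_true S c = nested_risk S c True False / nested_risk S c False False"

definition NDE_obs :: "('w, 'm, 'c, 'u) mediation \<Rightarrow> 'c \<Rightarrow> real" where
  "NDE_obs S c = standardized_risk S c True False / standardized_risk S c False False"

definition regularity :: "('w, 'm, 'c, 'u) mediation \<Rightarrow> 'c \<Rightarrow> bool" where
  "regularity S c \<longleftrightarrow>
     \<P>(\<omega> in law S. covariate S \<omega> = c) > 0 \<and>
     (\<forall>a. \<P>(\<omega> in law S. exposure S \<omega> = a \<bar> covariate S \<omega> = c) > 0) \<and>
     (\<forall>m. mediator_prob S c False m > 0 \<longrightarrow> mediator_prob S c True m > 0) \<and>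
     nested_risk S c False False > 0 \<and>
     standardized_risk S c False False > 0"

(* The ranges of the maxima: the m with P(m | A = 0, c) > 0 and the u with P(u | c) > 0. *)
definition mediator_support :: "('w, 'm, 'c, 'u) mediation \<Rightarrow> 'c \<Rightarrow> 'm set" where
  "mediator_support S c = {m. mediator_prob S c False m > 0}"

definition confounder_support :: "('w, 'm, 'c, 'u) mediation \<Rightarrow> 'c \<Rightarrow> 'u set" where
  "confounder_support S c =
     {u. \<P>(\<omega> in law S. confounder S \<omega> = u \<bar> covariate S \<omega> = c) > 0}"

(* P(Y = 1 | A = a, m, c, u), read as P(Y_am = 1 | c, u) if the conditioning event is null *)
definition outcome_risk ::
    "('w, 'm, 'c, 'u) mediation \<Rightarrow> 'c \<Rightarrow> bool \<Rightarrow> 'm \<Rightarrow> 'u \<Rightarrow> real" where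
  "outcome_risk S c a m u =
     (if \<P>(\<omega> in law S. exposure S \<omega> = a \<and> mediator S \<omega> = m \<and>
            covariate S \<omega> = c \<and> confounder S \<omega> = u) = 0
      then \<P>(\<omega> in law S. joint_pot_outcome S a m \<omega> \<bar>
            covariate S \<omega> = c \<and> confounder S \<omega> = u)
      else \<P>(\<omega> in law S. outcome S \<omega> \<bar>
            exposure S \<omega> = a \<and> mediator S \<omega> = m \<and>
            covariate S \<omega> = c \<and> confounder S \<omega> = u))"

(* P(u | A = a, m, c) *)
definition confounder_prob ::
    "('w, 'm, 'c, 'u) mediation \<Rightarrow> 'c \<Rightarrow> bool \<Rightarrow> 'm \<Rightarrow> 'u \<Rightarrow> real" where
  "confounder_prob S c a m u =
     \<P>(\<omega> in law S. confounder S \<omega> = u \<bar>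
         exposure S \<omega> = a \<and> mediator S \<omega> = m \<and> covariate S \<omega> = c)"

(* Division on ereal satisfies x / 0 = \<infinity> for x > 0 and x / \<infinity> = 0 for real x,
   as intended here.  It gives 0 / 0 = 0, so that case is treated separately. *)

definition RR_UY :: "('w, 'm, 'c, 'u) mediation \<Rightarrow> 'c \<Rightarrow> ereal" where
  "RR_UY S c =
     Max ((\<lambda>m.
       let hi = Max (outcome_risk S c True m ` confounder_support S c);
           lo = Min (outcome_risk S c True m ` confounder_support S c)
       in if hi = 0 \<and> lo = 0 then 1 else ereal hi / ereal lo) ` mediator_support S c)"

definition RR_AU :: "('w, 'm, 'c, 'u) mediation \<Rightarrow> 'c \<Rightarrow> ereal" where
  "RR_AU S c =
     Max ((\<lambda>m.
       Max ((\<lambda>u. ereal (confounder_prob S c True m u) / ereal (confounder_prob S c False m u)) `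
         {u \<in> confounder_support S c.
            \<not> (confounder_prob S c True m u = 0 \<and> confounder_prob S c False m u = 0)}))
       ` mediator_support S c)"

(* On ereal the fraction is not the intended limit when g or d is infinite. *)
definition bounding_factor :: "ereal \<Rightarrow> ereal \<Rightarrow> ereal" where
  "bounding_factor g d =
     (if g = \<infinity> \<and> d = \<infinity> then \<infinity>
      else if g = \<infinity> then d
      else if d = \<infinity> then g
      else g * d / (g + d - 1))"

definition BF :: "('w, 'm, 'c, 'u) mediation \<Rightarrow> 'c \<Rightarrow> ereal" where
  "BF S c = bounding_factor (RR_AU S c) (RR_UY S c)"

end

theory Submission
  imports Defs
begin

text \<open>
  Fix a level \<open>c\<close> and write \<open>r\<^sub>a(m,u)\<close> for \<open>P(Y\<^sub>a\<^sub>m = 1 | c, u)\<close> and \<open>w\<^sub>a(u|m)\<close> for \<open>P(u | A = a, m, c)\<close>.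

  \<^bold>\<open>Where the two effects differ.\<close> The independence assumptions say that within a stratum
  \<open>(c,u)\<close> nothing is confounded, and \<open>A \<bottom> U | C\<close> says that both exposure groups have the same
  distribution of \<open>U\<close>. Summing over the strata therefore gives
  \<open>P(Y\<^bsub>aM_0\<^esub> = 1 | c) = \<Sum>m (\<Sum>u r\<^sub>a(m,u) w\<^sub>0(u|m)) P(m | A = 0, c)\<close> (\<open>nested_risk_eq\<close>), whereas the
  observable quantity that stands in for it is
  \<open>\<Sum>m (\<Sum>u r\<^sub>a(m,u) w\<^sub>a(u|m)) P(m | A = 0, c)\<close> (\<open>standardized_risk_eq\<close>).
  For \<open>a = 0\<close> the two agree, so the true and the observed effect have the same denominator. For
  \<open>a = 1\<close> they differ because conditioning on the mediator, a common consequence of \<open>A\<close> and \<open>U\<close>,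
  makes \<open>U\<close> dependent on \<open>A\<close>: the weights are \<open>w\<^sub>1\<close> instead of \<open>w\<^sub>0\<close>.

  \<^bold>\<open>The bound.\<close> For each \<open>m\<close> it remains to compare two weighted means of the same function
  \<open>r = r\<^sub>1(m,\<cdot>)\<close>. The sensitivity parameters say that \<open>w\<^sub>1 \<le> \<gamma> w\<^sub>0\<close> pointwise and
  \<open>r(u) \<le> \<delta> r(v)\<close> for all \<open>u, v\<close>. Let \<open>E\<^sub>a = \<Sum>u r(u) w\<^sub>a(u)\<close>. Then \<open>E\<^sub>1 \<le> \<delta> r(v)\<close> for every \<open>v\<close>;
  multiplying by \<open>\<gamma> w\<^sub>0(v) - w\<^sub>1(v) \<ge> 0\<close> and summing over \<open>v\<close> yields
  \<open>(\<gamma> - 1) E\<^sub>1 \<le> \<delta> (\<gamma> E\<^sub>0 - E\<^sub>1)\<close>, that is, \<open>E\<^sub>1 \<le> BF E\<^sub>0\<close> (\<open>tilted_mean_bound\<close>). If only one of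
  the two parameters is finite, its hypothesis alone gives \<open>E\<^sub>1 \<le> \<gamma> E\<^sub>0\<close> or \<open>E\<^sub>1 \<le> \<delta> E\<^sub>0\<close>.

  \<^bold>\<open>Sharpness.\<close> If \<open>\<gamma>, \<delta> > 1\<close>, equality at an \<open>m\<close> with \<open>E\<^sub>1 > 0\<close> needs \<open>w\<^sub>1\<close> concentrated on the
  strata where \<open>r\<close> is largest and \<open>w\<^sub>1 = \<gamma> w\<^sub>0\<close> there, with \<open>r\<close> smaller by the factor \<open>\<delta>\<close> on all other
  strata that occur among the unexposed with this \<open>m\<close>. Since
  \<open>A \<bottom> U | C\<close>, such weights must be produced by selection through the mediator. Take
  \<open>U \<in> {0,1,2}\<close> with probabilities \<open>p, p, 1 - 2p\<close> where \<open>p = 1/(\<gamma> + 1)\<close>, \<open>M\<^sub>1 = U\<close> and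
  \<open>M\<^sub>0 = min 1 U\<close>. At \<open>m = 1\<close> the exposed all have \<open>U = 1\<close>, while of the unexposed only a
  proportion \<open>p/(1 - p) = 1/\<gamma>\<close> do. The other mediator value attained by the unexposed,
  \<open>m = 0\<close>, determines \<open>U = 0\<close> in both groups, and \<open>Y\<^sub>1\<^sub>0 = 0\<close> removes its contribution. The value
  \<open>m = 2\<close> does not occur among the unexposed, so it enters neither effect nor maximum.
\<close>

section \<open>Comparing two weighted means of one function\<close>

lemma weighted_mean_le_all:
  fixes w r :: "'u \<Rightarrow> real"
  assumes "\<And>u. u \<in> V \<Longrightarrow> 0 \<le> w u" "sum w V = 1" "\<And>u. u \<in> V \<Longrightarrow> r u \<le> b"
  shows "(\<Sum>u\<in>V. r u * w u) \<le> b"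
proof -
  have "(\<Sum>u\<in>V. r u * w u) \<le> (\<Sum>u\<in>V. b * w u)"
    by (intro sum_mono mult_right_mono assms)
  then show ?thesis using assms(2) by (simp flip: sum_distrib_left)
qed

text \<open>
  The mean \<open>E\<close> of \<open>r\<close> under \<open>w1\<close> is at most \<open>\<delta> * r v\<close> for every \<open>v\<close>. Averaging these
  inequalities with the nonnegative weights \<open>\<gamma> * w0 v - w1 v\<close>, of total mass \<open>\<gamma> - 1\<close>, bounds \<open>E\<close>
  by both means at once.
\<close>
lemma tilted_mean_bound:
  fixes w0 w1 r :: "'u \<Rightarrow> real"
  assumes w1: "\<And>u. u \<in> V \<Longrightarrow> 0 \<le> w1 u" "sum w1 V = 1" and w0: "sum w0 V = 1"
    and tilt: "\<And>u. u \<in> V \<Longrightarrow> w1 u \<le> \<gamma> * w0 u"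
    and ratio: "\<And>u v. u \<in> V \<Longrightarrow> v \<in> V \<Longrightarrow> r u \<le> \<delta> * r v"
    and "\<delta> > 0"
  shows "(\<gamma> + \<delta> - 1) * (\<Sum>u\<in>V. r u * w1 u) \<le> \<gamma> * \<delta> * (\<Sum>u\<in>V. r u * w0 u)"
proof -
  define E where "E = (\<Sum>u\<in>V. r u * w1 u)"
  have E: "E \<le> \<delta> * r v" if "v \<in> V" for v
    unfolding E_def by (rule weighted_mean_le_all) (use w1 ratio that in auto)
  have "(\<Sum>v\<in>V. E * (\<gamma> * w0 v - w1 v)) \<le> (\<Sum>v\<in>V. \<delta> * r v * (\<gamma> * w0 v - w1 v))"
    by (intro sum_mono mult_right_mono E) (use tilt in auto)
  also have "\<dots> = \<gamma> * \<delta> * (\<Sum>u\<in>V. r u * w0 u) - \<delta> * E"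
    unfolding E_def by (simp add: algebra_simps sum_subtractf sum_distrib_left)
  also have "(\<Sum>v\<in>V. E * (\<gamma> * w0 v - w1 v)) = E * (\<gamma> - 1)"
    using w0 w1(2) by (simp add: sum_subtractf right_diff_distrib flip: sum_distrib_left)
  finally show ?thesis unfolding E_def[symmetric] by (simp add: algebra_simps)
qed

section \<open>Conditional independence\<close>

text \<open>
  Clearing denominators turns the definition into an identity between joint probabilities, in
  which events can be rewritten by consistency.
\<close>
lemma cond_indep_joint:
  assumes "cond_indep P X Z W" and pos: "\<P>(\<omega> in P. W \<omega> = w) > 0"
  shows "\<P>(\<omega> in P. X \<omega> = x \<and> Z \<omega> = z \<and> W \<omega> = w) * \<P>(\<omega> in P. W \<omega> = w)
    = \<P>(\<omega> in P. X \<omega> = x \<and> W \<omega> = w) * \<P>(\<omega> in P. Z \<omega> = z \<and> W \<omega> = w)"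
proof -
  have "\<P>(\<omega> in P. X \<omega> = x \<and> Z \<omega> = z \<bar> W \<omega> = w) =
        \<P>(\<omega> in P. X \<omega> = x \<bar> W \<omega> = w) * \<P>(\<omega> in P. Z \<omega> = z \<bar> W \<omega> = w)"
    using assms by (auto simp: cond_indep_def)
  then show ?thesis using pos
    by (simp add: cond_prob_def field_simps conj_ac)
qed

lemma cond_indepI:
  assumes "\<And>x z w. \<P>(\<omega> in P. X \<omega> = x \<and> Z \<omega> = z \<and> W \<omega> = w) * \<P>(\<omega> in P. W \<omega> = w)
    = \<P>(\<omega> in P. X \<omega> = x \<and> W \<omega> = w) * \<P>(\<omega> in P. Z \<omega> = z \<and> W \<omega> = w)"
  shows "cond_indep P X Z W"
  using assms by (simp add: cond_indep_def cond_prob_def field_simps)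

text \<open>
  A variable that is constant given \<open>W\<close> is conditionally independent of everything. In the sharp
  model this covers every condition about a mediator: the potential mediators are functions of
  \<open>U\<close>, and the observed one is a function of \<open>(A, U)\<close>.
\<close>
lemma cond_indep_determined:
  assumes "\<And>\<omega>. \<omega> \<in> space P \<Longrightarrow> X \<omega> = h (W \<omega>)"
  shows "cond_indep P X Z W" and "cond_indep P Z X W"
proof -
  have XZ: "{\<omega>\<in>space P. (X \<omega> = x \<and> Z \<omega> = z) \<and> W \<omega> = w} =
      (if h w = x then {\<omega>\<in>space P. Z \<omega> = z \<and> W \<omega> = w} else {})"
    and X: "{\<omega>\<in>space P. X \<omega> = x \<and> W \<omega> = w} =
      (if h w = x then {\<omega>\<in>space P. W \<omega> = w} else {})" for x z w
    using assms by auto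
  have *: "\<P>(\<omega> in P. X \<omega> = x \<and> Z \<omega> = z \<bar> W \<omega> = w) =
     \<P>(\<omega> in P. X \<omega> = x \<bar> W \<omega> = w) * \<P>(\<omega> in P. Z \<omega> = z \<bar> W \<omega> = w)"
    if "\<P>(\<omega> in P. W \<omega> = w) > 0" for x z w
    using that unfolding cond_prob_def XZ X by simp
  show "cond_indep P X Z W" "cond_indep P Z X W"
    using * by (auto simp: cond_indep_def conj_commute mult.commute)
qed

section \<open>Risks as sums over the strata of the unmeasured covariate\<close>

text \<open>
  The sum runs over a chosen set \<open>R\<close> in place of the range of \<open>f\<close>, so that it can be taken over exactly
  the values of positive probability, which the maxima in the sensitivity parameters range over.
\<close>
lemma (in prob_space) prob_sum_simple_function:
  assumes f: "simple_function M f" and Q: "{\<omega> \<in> space M. Q \<omega>} \<in> events"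
    and R: "finite R" "\<And>x. x \<notin> R \<Longrightarrow> \<P>(\<omega> in M. Q \<omega> \<and> f \<omega> = x) = 0"
  shows "\<P>(\<omega> in M. Q \<omega>) = (\<Sum>x\<in>R. \<P>(\<omega> in M. Q \<omega> \<and> f \<omega> = x))"
proof -
  have [measurable]: "f \<in> measurable M (count_space UNIV)"
    using f by (rule measurable_simple_function)
  have [measurable]: "Measurable.pred M Q" using Q by (simp add: pred_def)
  have fin: "finite (f ` space M)" using f by (simp add: simple_function_def)
  have "\<P>(\<omega> in M. Q \<omega>) = prob (\<Union>x\<in>f ` space M. {\<omega>\<in>space M. Q \<omega> \<and> f \<omega> = x})"
    by (rule arg_cong[where f=prob]) auto
  also have "\<dots> = (\<Sum>x\<in>f ` space M. \<P>(\<omega> in M. Q \<omega> \<and> f \<omega> = x))"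
    using fin by (intro finite_measure_finite_Union) (auto simp: disjoint_family_on_def)
  also have "\<dots> = (\<Sum>x\<in>R \<union> f ` space M. \<P>(\<omega> in M. Q \<omega> \<and> f \<omega> = x))"
  proof (intro sum.mono_neutral_left ballI)
    fix x assume "x \<in> R \<union> f ` space M - f ` space M"
    then have "{\<omega>\<in>space M. Q \<omega> \<and> f \<omega> = x} = {}" by auto
    then show "\<P>(\<omega> in M. Q \<omega> \<and> f \<omega> = x) = 0" by (simp only: measure_empty)
  qed (use fin R in auto)
  also have "\<dots> = (\<Sum>x\<in>R. \<P>(\<omega> in M. Q \<omega> \<and> f \<omega> = x))"
    using fin R by (intro sum.mono_neutral_right) auto
  finally show ?thesis .
qed

text \<open>
  The formulas for the risks come before \<open>regularity\<close>, which is itself a statement about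
  these risks: in the sharp model it is verified by means of the formulas.
\<close>
locale unconfounded_mediation =
  fixes S :: "('w, 'm, 'c, 'u) mediation" and c :: 'c
  assumes model: "mediation_model S"
    and indep: "independence_assumptions S"
    and covariate_pos: "\<P>(\<omega> in law S. covariate S \<omega> = c) > 0"
    and exposure_pos: "\<And>a. \<P>(\<omega> in law S. exposure S \<omega> = a \<bar> covariate S \<omega> = c) > 0"
begin

sublocale prob_space "law S"
  using model by (simp add: mediation_model_def)

lemma simple [simp, intro]:
  "simple_function (law S) (exposure S)"
  "simple_function (law S) (outcome S)"
  "simple_function (law S) (mediator S)"
  "simple_function (law S) (covariate S)"
  "simple_function (law S) (confounder S)"
  "simple_function (law S) (pot_mediator S a)"
  "simple_function (law S) (joint_pot_outcome S a m)"
  using model by (auto simp: mediation_model_def)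

lemmas simple_measurable [measurable] = simple[THEN measurable_simple_function]

lemma consistent:
  assumes "\<omega> \<in> space (law S)"
  shows "mediator S \<omega> = pot_mediator S (exposure S \<omega>) \<omega>"
    and "outcome S \<omega> = joint_pot_outcome S (exposure S \<omega>) (mediator S \<omega>) \<omega>"
  using model assms unfolding mediation_model_def by metis+

text \<open>
  The potential outcome is evaluated at a random mediator value; since that takes finitely many
  values, the event is a finite union of measurable ones.
\<close>
lemma nested_outcome_measurable [measurable]:
  "Measurable.pred (law S) (nested_outcome S a a')"
proof -
  have "(\<lambda>\<omega>. \<exists>m \<in> pot_mediator S a' ` space (law S). pot_mediator S a' \<omega> = m \<and> joint_pot_outcome S a m \<omega>)
      \<in> measurable (law S) (count_space UNIV)"
    using simple(6)[of a'] by (intro pred_intros_finite) (auto simp: simple_function_def)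
  moreover have "(\<lambda>\<omega>. \<exists>m \<in> pot_mediator S a' ` space (law S). pot_mediator S a' \<omega> = m \<and> joint_pot_outcome S a m \<omega>)
      \<in> measurable (law S) (count_space UNIV) \<longleftrightarrow> ?thesis"
    by (intro measurable_cong) (auto simp: nested_outcome_def)
  ultimately show ?thesis by simp
qed

definition pot_risk :: "bool \<Rightarrow> 'm \<Rightarrow> 'u \<Rightarrow> real" where
  "pot_risk a m u = \<P>(\<omega> in law S. joint_pot_outcome S a m \<omega> \<bar> covariate S \<omega> = c \<and> confounder S \<omega> = u)"

text \<open>
  The joint probability, and not the conditional one given the stratum, is the factor shared by all
  the stratum masses below; summed over \<open>u\<close> it gives the mediator distribution directly.
\<close>
definition pot_mediator_mass :: "bool \<Rightarrow> 'm \<Rightarrow> 'u \<Rightarrow> real" where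
  "pot_mediator_mass a m u =
     \<P>(\<omega> in law S. pot_mediator S a \<omega> = m \<and> covariate S \<omega> = c \<and> confounder S \<omega> = u)"

definition exposure_prob :: "bool \<Rightarrow> real" where
  "exposure_prob a = \<P>(\<omega> in law S. exposure S \<omega> = a \<bar> covariate S \<omega> = c)"

lemma pot_risk_nonneg: "0 \<le> pot_risk a m u"
  by (simp add: pot_risk_def cond_prob_def)

lemma pot_mediator_mass_nonneg: "0 \<le> pot_mediator_mass a m u"
  by (simp add: pot_mediator_mass_def)

lemma exposure_prob_pos: "exposure_prob a > 0"
  using exposure_pos by (simp add: exposure_prob_def)

lemma confounder_support_iff:
  "u \<in> confounder_support S c \<longleftrightarrow> \<P>(\<omega> in law S. covariate S \<omega> = c \<and> confounder S \<omega> = u) > 0"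
  using covariate_pos
  by (simp add: confounder_support_def cond_prob_def zero_less_divide_iff conj_commute)

lemma finite_confounder_support: "finite (confounder_support S c)"
proof (rule finite_subset)
  show "confounder_support S c \<subseteq> confounder S ` space (law S)"
  proof
    fix u assume "u \<in> confounder_support S c"
    then have "{\<omega> \<in> space (law S). covariate S \<omega> = c \<and> confounder S \<omega> = u} \<noteq> {}"
      unfolding confounder_support_iff by (metis less_irrefl measure_empty)
    then show "u \<in> confounder S ` space (law S)" by auto
  qed
  show "finite (confounder S ` space (law S))"
    using simple(5) by (simp add: simple_function_def)
qed

lemma prob_sum_confounder:
  assumes [measurable]: "Measurable.pred (law S) Q"
  shows "\<P>(\<omega> in law S. Q \<omega> \<and> covariate S \<omega> = c) =
    (\<Sum>u\<in>confounder_support S c. \<P>(\<omega> in law S. Q \<omega> \<and> covariate S \<omega> = c \<and> confounder S \<omega> = u))"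
proof -
  have "\<P>(\<omega> in law S. (Q \<omega> \<and> covariate S \<omega> = c) \<and> confounder S \<omega> = u) = 0"
    if "u \<notin> confounder_support S c" for u
  proof -
    have "\<P>(\<omega> in law S. (Q \<omega> \<and> covariate S \<omega> = c) \<and> confounder S \<omega> = u)
        \<le> \<P>(\<omega> in law S. covariate S \<omega> = c \<and> confounder S \<omega> = u)"
      by (intro finite_measure_mono) auto
    also have "\<dots> \<le> 0" using that by (simp add: confounder_support_iff not_less)
    finally show ?thesis by (simp add: measure_le_0_iff)
  qed
  from prob_sum_simple_function[OF simple(5) _ finite_confounder_support this]
  show ?thesis by simp
qed

text \<open>
  By \<open>A \<bottom> U | C\<close> the exposure probability is the same in all strata. This is why
  \<open>exposure_prob a\<close> factors out of every sum over strata and cancels.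
\<close>
lemma exposure_stratum:
  assumes "u \<in> confounder_support S c"
  shows "\<P>(\<omega> in law S. exposure S \<omega> = a \<and> covariate S \<omega> = c \<and> confounder S \<omega> = u) =
    exposure_prob a * \<P>(\<omega> in law S. covariate S \<omega> = c \<and> confounder S \<omega> = u)"
proof -
  have "cond_indep (law S) (exposure S) (confounder S) (covariate S)"
    using indep by (simp add: independence_assumptions_def)
  from cond_indep_joint[OF this covariate_pos, of a u] show ?thesis
    using covariate_pos
    by (simp add: exposure_prob_def cond_prob_def field_simps conj_ac)
qed

lemma mediator_stratum:
  assumes u: "u \<in> confounder_support S c"
  shows "\<P>(\<omega> in law S. exposure S \<omega> = a \<and> mediator S \<omega> = m \<and> covariate S \<omega> = c \<and> confounder S \<omega> = u) =
    exposure_prob a * pot_mediator_mass a m u"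
proof -
  have "cond_indep (law S) (pot_mediator S a) (exposure S) (\<lambda>\<omega>. (covariate S \<omega>, confounder S \<omega>))"
    using indep by (simp add: independence_assumptions_def)
  from cond_indep_joint[OF this, of "(c, u)" m a]
  have "\<P>(\<omega> in law S. pot_mediator S a \<omega> = m \<and> exposure S \<omega> = a \<and> covariate S \<omega> = c \<and> confounder S \<omega> = u)
     = exposure_prob a * pot_mediator_mass a m u"
    using u by (simp add: confounder_support_iff exposure_stratum[OF u] pot_mediator_mass_def)
  also have "{\<omega> \<in> space (law S). pot_mediator S a \<omega> = m \<and> exposure S \<omega> = a \<and> covariate S \<omega> = c \<and> confounder S \<omega> = u}
     = {\<omega> \<in> space (law S). exposure S \<omega> = a \<and> mediator S \<omega> = m \<and> covariate S \<omega> = c \<and> confounder S \<omega> = u}"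
    using consistent(1) by auto
  finally show ?thesis .
qed

text \<open>
  On the event \<open>A = a, M = m\<close> the outcome is \<open>Y\<^sub>a\<^sub>m\<close>. Its independence of \<open>M\<close> given \<open>(A,C,U)\<close> drops
  the condition on the mediator, then its independence of \<open>A\<close> given \<open>(C,U)\<close> the one on the exposure.
\<close>
lemma outcome_stratum:
  assumes u: "u \<in> confounder_support S c"
  shows "\<P>(\<omega> in law S. outcome S \<omega> \<and> exposure S \<omega> = a \<and> mediator S \<omega> = m \<and> covariate S \<omega> = c \<and> confounder S \<omega> = u) =
    exposure_prob a * (pot_risk a m u * pot_mediator_mass a m u)"
proof -
  let ?P = "\<P>(\<omega> in law S. covariate S \<omega> = c \<and> confounder S \<omega> = u)"
  let ?Y = "joint_pot_outcome S a m"
  have P: "?P > 0" using u by (simp add: confounder_support_iff)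
  have A: "\<P>(\<omega> in law S. exposure S \<omega> = a \<and> covariate S \<omega> = c \<and> confounder S \<omega> = u) > 0"
    using P exposure_prob_pos by (simp add: exposure_stratum[OF u])
  have YA: "cond_indep (law S) ?Y (exposure S) (\<lambda>\<omega>. (covariate S \<omega>, confounder S \<omega>))"
    and YM: "cond_indep (law S) ?Y (mediator S) (\<lambda>\<omega>. (exposure S \<omega>, covariate S \<omega>, confounder S \<omega>))"
    using indep by (simp_all add: independence_assumptions_def)
  have 1: "\<P>(\<omega> in law S. ?Y \<omega> \<and> exposure S \<omega> = a \<and> covariate S \<omega> = c \<and> confounder S \<omega> = u)
     = exposure_prob a * (pot_risk a m u * ?P)"
    using cond_indep_joint[OF YA, of "(c, u)" True a] P
    by (simp add: exposure_stratum[OF u] pot_risk_def cond_prob_def)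
  have 2: "\<P>(\<omega> in law S. mediator S \<omega> = m \<and> exposure S \<omega> = a \<and> covariate S \<omega> = c \<and> confounder S \<omega> = u)
     = exposure_prob a * pot_mediator_mass a m u"
    unfolding mediator_stratum[OF u, symmetric] by (rule arg_cong[where f=prob]) auto
  have "\<P>(\<omega> in law S. ?Y \<omega> \<and> mediator S \<omega> = m \<and> exposure S \<omega> = a \<and> covariate S \<omega> = c \<and> confounder S \<omega> = u)
      * (exposure_prob a * ?P) =
      exposure_prob a * (pot_risk a m u * ?P) * (exposure_prob a * pot_mediator_mass a m u)"
    using cond_indep_joint[OF YM, of "(a, c, u)" True m] A
    by (simp add: 1 2 exposure_stratum[OF u])
  then have "\<P>(\<omega> in law S. ?Y \<omega> \<and> mediator S \<omega> = m \<and> exposure S \<omega> = a \<and> covariate S \<omega> = c \<and> confounder S \<omega> = u)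
      = exposure_prob a * (pot_risk a m u * pot_mediator_mass a m u)"
    using P exposure_prob_pos[of a] by (simp add: field_simps)
  also have "{\<omega> \<in> space (law S). ?Y \<omega> \<and> mediator S \<omega> = m \<and> exposure S \<omega> = a \<and> covariate S \<omega> = c \<and> confounder S \<omega> = u}
     = {\<omega> \<in> space (law S). outcome S \<omega> \<and> exposure S \<omega> = a \<and> mediator S \<omega> = m \<and> covariate S \<omega> = c \<and> confounder S \<omega> = u}"
    using consistent(2) by auto
  finally show ?thesis .
qed

text \<open>
  The cross-world assumption \<open>Y\<^sub>a\<^sub>m \<bottom> M\<^bsub>a'\<^esub> | (C,U)\<close> enters here. For \<open>a \<noteq> a'\<close> outcome and
  mediator belong to different exposures and are never observed together.
\<close>
lemma nested_stratum:
  assumes u: "u \<in> confounder_support S c"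
  shows "\<P>(\<omega> in law S. nested_outcome S a a' \<omega> \<and> pot_mediator S a' \<omega> = m \<and> covariate S \<omega> = c \<and> confounder S \<omega> = u) =
    pot_risk a m u * pot_mediator_mass a' m u"
proof -
  have "cond_indep (law S) (joint_pot_outcome S a m) (pot_mediator S a') (\<lambda>\<omega>. (covariate S \<omega>, confounder S \<omega>))"
    using indep by (simp add: independence_assumptions_def)
  from cond_indep_joint[OF this, of "(c, u)" True m]
  have "\<P>(\<omega> in law S. joint_pot_outcome S a m \<omega> \<and> pot_mediator S a' \<omega> = m \<and> covariate S \<omega> = c \<and> confounder S \<omega> = u)
     = pot_risk a m u * pot_mediator_mass a' m u"
    using u by (simp add: confounder_support_iff pot_risk_def pot_mediator_mass_def cond_prob_def field_simps)
  also have "{\<omega> \<in> space (law S). joint_pot_outcome S a m \<omega> \<and> pot_mediator S a' \<omega> = m \<and> covariate S \<omega> = c \<and> confounder S \<omega> = u}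
    = {\<omega> \<in> space (law S). nested_outcome S a a' \<omega> \<and> pot_mediator S a' \<omega> = m \<and> covariate S \<omega> = c \<and> confounder S \<omega> = u}"
    by (auto simp: nested_outcome_def)
  finally show ?thesis .
qed

text \<open>
  The two branches of \<open>outcome_risk\<close> agree, so a mediator value that is impossible in a stratum
  needs no separate treatment.
\<close>
lemma outcome_risk_eq_pot_risk:
  assumes u: "u \<in> confounder_support S c"
  shows "outcome_risk S c a m u = pot_risk a m u"
  using outcome_stratum[OF u, of a m] mediator_stratum[OF u, of a m] exposure_prob_pos[of a]
  by (auto simp: outcome_risk_def pot_risk_def cond_prob_def)

lemma mediator_exposure_prob:
  "\<P>(\<omega> in law S. exposure S \<omega> = a \<and> mediator S \<omega> = m \<and> covariate S \<omega> = c) =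
    exposure_prob a * (\<Sum>u\<in>confounder_support S c. pot_mediator_mass a m u)"
  using prob_sum_confounder[of "\<lambda>\<omega>. exposure S \<omega> = a \<and> mediator S \<omega> = m"]
  by (simp add: mediator_stratum sum_distrib_left)

lemma mediator_prob_eq:
  "mediator_prob S c a m =
    (\<Sum>u\<in>confounder_support S c. pot_mediator_mass a m u) / \<P>(\<omega> in law S. covariate S \<omega> = c)"
proof -
  have "\<P>(\<omega> in law S. exposure S \<omega> = a \<and> covariate S \<omega> = c) = exposure_prob a * \<P>(\<omega> in law S. covariate S \<omega> = c)"
    using covariate_pos by (simp add: exposure_prob_def cond_prob_def)
  then show ?thesis
    using mediator_exposure_prob[of a m] exposure_prob_pos[of a]
    by (simp add: mediator_prob_def cond_prob_def conj_ac)
qed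

lemma confounder_prob_eq:
  assumes u: "u \<in> confounder_support S c"
  shows "confounder_prob S c a m u =
    pot_mediator_mass a m u / (\<Sum>v\<in>confounder_support S c. pot_mediator_mass a m v)"
  using mediator_exposure_prob[of a m] mediator_stratum[OF u, of a m] exposure_prob_pos[of a]
  by (simp add: confounder_prob_def cond_prob_def conj_ac)

lemma observed_risk_eq:
  "\<P>(\<omega> in law S. outcome S \<omega> \<bar> exposure S \<omega> = a \<and> mediator S \<omega> = m \<and> covariate S \<omega> = c) =
    (\<Sum>u\<in>confounder_support S c. pot_risk a m u * confounder_prob S c a m u)"
proof -
  have "\<P>(\<omega> in law S. outcome S \<omega> \<and> exposure S \<omega> = a \<and> mediator S \<omega> = m \<and> covariate S \<omega> = c) =
     exposure_prob a * (\<Sum>u\<in>confounder_support S c. pot_risk a m u * pot_mediator_mass a m u)"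
    using prob_sum_confounder[of "\<lambda>\<omega>. outcome S \<omega> \<and> exposure S \<omega> = a \<and> mediator S \<omega> = m"]
    by (simp add: outcome_stratum sum_distrib_left)
  then show ?thesis
    using mediator_exposure_prob[of a m] exposure_prob_pos[of a]
    by (simp add: cond_prob_def confounder_prob_eq sum_divide_distrib)
qed

lemma finite_mediator_support: "finite (mediator_support S c)"
  and mediator_support_subset: "mediator_support S c \<subseteq> mediator S ` space (law S)"
proof -
  show *: "mediator_support S c \<subseteq> mediator S ` space (law S)"
  proof
    fix m assume "m \<in> mediator_support S c"
    then have "\<P>(\<omega> in law S. exposure S \<omega> = False \<and> mediator S \<omega> = m \<and> covariate S \<omega> = c) \<noteq> 0"
      by (auto simp: mediator_support_def mediator_prob_def cond_prob_def conj_ac)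
    then have "{\<omega> \<in> space (law S). exposure S \<omega> = False \<and> mediator S \<omega> = m \<and> covariate S \<omega> = c} \<noteq> {}"
      by (metis measure_empty)
    then show "m \<in> mediator S ` space (law S)" by auto
  qed
  show "finite (mediator_support S c)"
    using finite_subset[OF *] simple(3) by (simp add: simple_function_def)
qed

lemma outside_mediator_support:
  assumes "m \<notin> mediator_support S c"
  shows "mediator_prob S c False m = 0"
    and "u \<in> confounder_support S c \<Longrightarrow> pot_mediator_mass False m u = 0"
proof -
  have "mediator_prob S c False m \<ge> 0"
    by (simp add: mediator_prob_def cond_prob_def)
  with assms show 0: "mediator_prob S c False m = 0"
    by (simp add: mediator_support_def)
  show "pot_mediator_mass False m u = 0" if "u \<in> confounder_support S c"
    using 0 that covariate_pos
    by (auto simp: mediator_prob_eq sum_nonneg_eq_0_iff finite_confounder_support pot_mediator_mass_nonneg)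
qed

lemma unexposed_mass_pos:
  assumes "m \<in> mediator_support S c"
  shows "(\<Sum>u\<in>confounder_support S c. pot_mediator_mass False m u) > 0"
  using assms covariate_pos
  by (simp add: mediator_support_def mediator_prob_eq zero_less_divide_iff)

text \<open>
  The next two identities differ only in the exposure at which the distribution of \<open>U\<close> given the
  mediator is taken. This difference is the whole bias of the observed effect.
\<close>
lemma standardized_risk_eq:
  "standardized_risk S c a False = (\<Sum>m\<in>mediator_support S c.
     (\<Sum>u\<in>confounder_support S c. pot_risk a m u * confounder_prob S c a m u) * mediator_prob S c False m)"
  unfolding standardized_risk_def observed_risk_eq
  using simple(3) mediator_support_subset
  by (intro sum.mono_neutral_right) (auto simp: simple_function_def outside_mediator_support)

lemma nested_risk_eq:
  "nested_risk S c a False = (\<Sum>m\<in>mediator_support S c.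
     (\<Sum>u\<in>confounder_support S c. pot_risk a m u * confounder_prob S c False m u) * mediator_prob S c False m)"
proof -
  let ?pC = "\<P>(\<omega> in law S. covariate S \<omega> = c)"
  let ?N = "nested_outcome S a False"
  have m: "\<P>(\<omega> in law S. (?N \<omega> \<and> covariate S \<omega> = c) \<and> pot_mediator S False \<omega> = m)
    = (\<Sum>u\<in>confounder_support S c. pot_risk a m u * pot_mediator_mass False m u)" for m
  proof -
    have "\<P>(\<omega> in law S. (?N \<omega> \<and> covariate S \<omega> = c) \<and> pot_mediator S False \<omega> = m)
        = \<P>(\<omega> in law S. (?N \<omega> \<and> pot_mediator S False \<omega> = m) \<and> covariate S \<omega> = c)"
      by (rule arg_cong[where f=prob]) auto
    then show ?thesis
      using prob_sum_confounder[of "\<lambda>\<omega>. ?N \<omega> \<and> pot_mediator S False \<omega> = m"]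
      by (simp add: nested_stratum)
  qed
  have "\<P>(\<omega> in law S. ?N \<omega> \<and> covariate S \<omega> = c) =
     (\<Sum>m\<in>mediator_support S c. \<P>(\<omega> in law S. (?N \<omega> \<and> covariate S \<omega> = c) \<and> pot_mediator S False \<omega> = m))"
  proof (rule prob_sum_simple_function)
    fix m assume "m \<notin> mediator_support S c"
    then show "\<P>(\<omega> in law S. (?N \<omega> \<and> covariate S \<omega> = c) \<and> pot_mediator S False \<omega> = m) = 0"
      unfolding m by (simp add: outside_mediator_support)
  qed (simp_all add: finite_mediator_support)
  then have "nested_risk S c a False =
     (\<Sum>m\<in>mediator_support S c. (\<Sum>u\<in>confounder_support S c. pot_risk a m u * pot_mediator_mass False m u) / ?pC)"
    unfolding m nested_risk_def cond_prob_def by (simp add: sum_divide_distrib)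
  also have "\<dots> = (\<Sum>m\<in>mediator_support S c.
     (\<Sum>u\<in>confounder_support S c. pot_risk a m u * confounder_prob S c False m u) * mediator_prob S c False m)"
  proof (rule sum.cong[OF refl])
    fix m assume "m \<in> mediator_support S c"
    then show "(\<Sum>u\<in>confounder_support S c. pot_risk a m u * pot_mediator_mass False m u) / ?pC =
      (\<Sum>u\<in>confounder_support S c. pot_risk a m u * confounder_prob S c False m u) * mediator_prob S c False m"
      using unexposed_mass_pos[of m]
      by (simp add: confounder_prob_eq mediator_prob_eq flip: sum_divide_distrib)
  qed
  finally show ?thesis .
qed

lemma standardized_risk_unexposed: "standardized_risk S c False False = nested_risk S c False False"
  by (simp add: standardized_risk_eq nested_risk_eq)


end

section \<open>The lower bound on the natural direct effect\<close>

locale regular_mediation = unconfounded_mediation +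
  assumes reg: "regularity S c"
begin

lemma mediator_mass_pos:
  assumes "m \<in> mediator_support S c"
  shows "(\<Sum>u\<in>confounder_support S c. pot_mediator_mass a m u) > 0"
proof -
  have "mediator_prob S c a m > 0"
    using assms reg by (cases a) (auto simp: mediator_support_def regularity_def)
  then show ?thesis
    using covariate_pos by (simp add: mediator_prob_eq zero_less_divide_iff)
qed

lemma confounder_prob_sum:
  assumes "m \<in> mediator_support S c"
  shows "(\<Sum>u\<in>confounder_support S c. confounder_prob S c a m u) = 1"
  using mediator_mass_pos[OF assms, of a]
  by (simp add: confounder_prob_eq flip: sum_divide_distrib)

lemma confounder_prob_nonneg: "0 \<le> confounder_prob S c a m u"
  by (simp add: confounder_prob_def cond_prob_def)

lemma confounder_support_nonempty: "confounder_support S c \<noteq> {}"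
  using prob_sum_confounder[of "\<lambda>_. True"] covariate_pos by auto

lemma mediator_support_nonempty: "mediator_support S c \<noteq> {}"
  using reg by (auto simp: regularity_def standardized_risk_eq)

lemma RR_AU_ge_ratio:
  assumes "m \<in> mediator_support S c" "u \<in> confounder_support S c"
    and "\<not> (confounder_prob S c True m u = 0 \<and> confounder_prob S c False m u = 0)"
  shows "ereal (confounder_prob S c True m u) / ereal (confounder_prob S c False m u) \<le> RR_AU S c"
proof -
  let ?R = "\<lambda>m. (\<lambda>u. ereal (confounder_prob S c True m u) / ereal (confounder_prob S c False m u)) `
    {u \<in> confounder_support S c. \<not> (confounder_prob S c True m u = 0 \<and> confounder_prob S c False m u = 0)}"
  have "ereal (confounder_prob S c True m u) / ereal (confounder_prob S c False m u) \<le> Max (?R m)"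
    using assms finite_confounder_support by (intro Max_ge imageI) auto
  also have "\<dots> \<le> RR_AU S c"
    unfolding RR_AU_def using assms(1) finite_mediator_support
    by (intro Max_ge imageI) auto
  finally show ?thesis .
qed

text \<open>
  A finite \<open>RR_AU\<close> excludes strata with \<open>P(u | A = 0, m, c) = 0 < P(u | A = 1, m, c)\<close>, whose ratio
  is infinite; strata omitted from the maximum satisfy the inequality as \<open>0 \<le> 0\<close>.
\<close>
lemma RR_AU_tilt:
  assumes "RR_AU S c = ereal \<gamma>" "m \<in> mediator_support S c" "u \<in> confounder_support S c"
  shows "confounder_prob S c True m u \<le> \<gamma> * confounder_prob S c False m u"
proof (cases "confounder_prob S c True m u = 0 \<and> confounder_prob S c False m u = 0")
  case False
  have "ereal (confounder_prob S c True m u) / ereal (confounder_prob S c False m u) \<le> ereal \<gamma>"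
    using RR_AU_ge_ratio[OF assms(2,3) False] assms(1) by simp
  then show ?thesis
    using False confounder_prob_nonneg[of True m u] confounder_prob_nonneg[of False m u]
    by (cases "confounder_prob S c False m u = 0") (auto simp: field_simps)
qed simp

text \<open>
  Two probability vectors on the same finite set: some entry of positive mass under the first
  must be at least the corresponding entry of the second.
\<close>
lemma RR_AU_ge_1: "1 \<le> RR_AU S c"
proof -
  obtain m where m: "m \<in> mediator_support S c" using mediator_support_nonempty by auto
  let ?w = "\<lambda>a. confounder_prob S c a m"
  have "\<exists>u\<in>confounder_support S c. ?w True u > 0 \<and> ?w False u \<le> ?w True u"
  proof (rule ccontr)
    assume *: "\<not> ?thesis"
    then have le: "?w True u \<le> ?w False u" if "u \<in> confounder_support S c" for u
      using that confounder_prob_nonneg[of True m u] confounder_prob_nonneg[of False m u]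
      by (cases "?w True u > 0") auto
    have "?w True u = ?w False u" if "u \<in> confounder_support S c" for u
      by (rule sum_mono_inv[of "?w True" "confounder_support S c" "?w False"])
        (use le that confounder_prob_sum[OF m] finite_confounder_support in auto)
    with * have "?w True u = 0" if "u \<in> confounder_support S c" for u
      using that confounder_prob_nonneg[of True m u] by force
    then show False using confounder_prob_sum[OF m, of True] by simp
  qed
  then obtain u where u: "u \<in> confounder_support S c" "?w True u > 0" "?w False u \<le> ?w True u"
    by auto
  have "1 \<le> ereal (?w True u) / ereal (?w False u)"
    using u confounder_prob_nonneg[of False m u]
    by (cases "?w False u = 0") (auto simp: field_simps one_ereal_def)
  also have "\<dots> \<le> RR_AU S c" using m u by (intro RR_AU_ge_ratio) auto
  finally show ?thesis .
qed

lemma RR_UY_ge_ratio: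
  assumes "m \<in> mediator_support S c"
    and "hi = Max (pot_risk True m ` confounder_support S c)"
    and "lo = Min (pot_risk True m ` confounder_support S c)"
  shows "(if hi = 0 \<and> lo = 0 then 1 else ereal hi / ereal lo) \<le> RR_UY S c"
proof -
  have "outcome_risk S c True m ` confounder_support S c = pot_risk True m ` confounder_support S c"
    by (simp add: outcome_risk_eq_pot_risk)
  then show ?thesis
    unfolding RR_UY_def Let_def assms(2,3)
    by (intro order_trans[OF _ Max_ge[OF _ imageI[OF assms(1)]]])
      (auto simp: finite_mediator_support)
qed

lemma pot_risk_Max_Min:
  assumes "u \<in> confounder_support S c"
  shows "pot_risk a m u \<le> Max (pot_risk a m ` confounder_support S c)"
    and "Min (pot_risk a m ` confounder_support S c) \<le> pot_risk a m u"
    and "0 \<le> Min (pot_risk a m ` confounder_support S c)"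
  using assms finite_confounder_support pot_risk_nonneg by (auto intro!: Min.boundedI)

text \<open>
  If the smallest risk is zero while \<open>RR_UY\<close> is finite, the largest one is zero as well: this is the
  case \<open>0 / 0\<close>, in which all risks vanish.
\<close>
lemma RR_UY_ratio:
  assumes "RR_UY S c = ereal \<delta>" "m \<in> mediator_support S c"
    and u: "u \<in> confounder_support S c" and v: "v \<in> confounder_support S c"
  shows "pot_risk True m u \<le> \<delta> * pot_risk True m v"
proof -
  define hi lo where "hi = Max (pot_risk True m ` confounder_support S c)"
    and "lo = Min (pot_risk True m ` confounder_support S c)"
  note b = pot_risk_Max_Min[of _ True m, folded hi_def lo_def]
  have le: "(if hi = 0 \<and> lo = 0 then 1 else ereal hi / ereal lo) \<le> ereal \<delta>"
    using RR_UY_ge_ratio[OF assms(2) hi_def lo_def] assms(1) by simp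
  show ?thesis
  proof (cases "lo = 0")
    case True
    then have "hi = 0" using le b[OF u] by (auto split: if_splits)
    then show ?thesis using b[OF u] b[OF v] True pot_risk_nonneg[of True m u] pot_risk_nonneg[of True m v] by auto
  next
    case False
    then have "hi \<le> \<delta> * lo" "lo > 0" using le b(3)[OF u] by (auto simp: field_simps)
    moreover have "\<delta> \<ge> 0" using calculation b[OF u]
      by (smt (verit) mult_neg_pos)
    ultimately show ?thesis using b[OF u] b[OF v]
      by (meson mult_left_mono order_trans)
  qed
qed

lemma RR_UY_ge_1: "1 \<le> RR_UY S c"
proof -
  obtain m u where m: "m \<in> mediator_support S c" and u: "u \<in> confounder_support S c"
    using mediator_support_nonempty confounder_support_nonempty by auto
  define hi lo where "hi = Max (pot_risk True m ` confounder_support S c)"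
    and "lo = Min (pot_risk True m ` confounder_support S c)"
  note b = pot_risk_Max_Min[OF u, of True m, folded hi_def lo_def]
  have "1 \<le> (if hi = 0 \<and> lo = 0 then 1 else ereal hi / ereal lo)"
    using b by (cases "lo = 0") (auto simp: field_simps one_ereal_def)
  also have "\<dots> \<le> RR_UY S c" by (rule RR_UY_ge_ratio[OF m hi_def lo_def])
  finally show ?thesis .
qed

text \<open>
  The inequality between the two means is established separately for each \<open>m\<close>, always with the same
  constant; the three cases correspond to which sensitivity parameters are finite.
\<close>
lemma standardized_risk_le:
  assumes BF: "BF S c \<noteq> \<infinity>"
  obtains b where "b > 0" "BF S c = ereal b"
    "standardized_risk S c True False \<le> b * nested_risk S c True False"
proof -
  note result = that
  let ?V = "confounder_support S c"
  define E where "E a m = (\<Sum>u\<in>?V. pot_risk True m u * confounder_prob S c a m u)" for a m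
  have main: thesis if b: "b > 0" "BF S c = ereal b" and le: "\<And>m. m \<in> mediator_support S c \<Longrightarrow> E True m \<le> b * E False m" for b
  proof -
    have "standardized_risk S c True False \<le> (\<Sum>m\<in>mediator_support S c. b * E False m * mediator_prob S c False m)"
      unfolding standardized_risk_eq E_def[symmetric]
      by (intro sum_mono mult_right_mono le) (auto simp: mediator_support_def)
    also have "\<dots> = b * nested_risk S c True False"
      unfolding nested_risk_eq E_def[symmetric] by (simp add: sum_distrib_left mult.assoc)
    finally show thesis by (rule result[OF b])
  qed
  have fin_AU: "RR_AU S c = \<infinity> \<or> (\<exists>\<gamma>\<ge>1. RR_AU S c = ereal \<gamma>)"
    using RR_AU_ge_1 by (cases "RR_AU S c") auto
  have fin_UY: "RR_UY S c = \<infinity> \<or> (\<exists>\<delta>\<ge>1. RR_UY S c = ereal \<delta>)"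
    using RR_UY_ge_1 by (cases "RR_UY S c") auto
  have by_AU: "E True m \<le> \<gamma> * E False m" if "RR_AU S c = ereal \<gamma>" "m \<in> mediator_support S c" for \<gamma> m
  proof -
    have "E True m \<le> (\<Sum>u\<in>?V. pot_risk True m u * (\<gamma> * confounder_prob S c False m u))"
      unfolding E_def by (intro sum_mono mult_left_mono RR_AU_tilt that pot_risk_nonneg)
    then show ?thesis by (simp add: E_def sum_distrib_left mult.left_commute)
  qed
  have by_UY: "E True m \<le> \<delta> * E False m" if d: "RR_UY S c = ereal \<delta>" and m: "m \<in> mediator_support S c" for \<delta> m
  proof -
    have 1: "E True m \<le> \<delta> * pot_risk True m v" if "v \<in> ?V" for v
      unfolding E_def
      by (rule weighted_mean_le_all) (use RR_UY_ratio[OF d m _ that] confounder_prob_nonneg confounder_prob_sum[OF m] in auto)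
    have "(\<Sum>v\<in>?V. E True m * confounder_prob S c False m v) \<le> (\<Sum>v\<in>?V. \<delta> * pot_risk True m v * confounder_prob S c False m v)"
      by (intro sum_mono mult_right_mono 1 confounder_prob_nonneg)
    then show ?thesis
      using confounder_prob_sum[OF m, of False]
      by (simp add: E_def mult.assoc flip: sum_distrib_left)
  qed
  consider (AU) \<gamma> where "\<gamma> \<ge> 1" "RR_AU S c = ereal \<gamma>" "RR_UY S c = \<infinity>"
    | (UY) \<delta> where "\<delta> \<ge> 1" "RR_UY S c = ereal \<delta>" "RR_AU S c = \<infinity>"
    | (both) \<gamma> \<delta> where "\<gamma> \<ge> 1" "RR_AU S c = ereal \<gamma>" "\<delta> \<ge> 1" "RR_UY S c = ereal \<delta>"
  proof -
    have "\<not> (RR_AU S c = \<infinity> \<and> RR_UY S c = \<infinity>)"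
      using BF by (auto simp: BF_def bounding_factor_def)
    then show ?thesis using fin_AU fin_UY that by blast
  qed
  then show thesis
  proof cases
    case AU
    then show ?thesis by (intro main[of \<gamma>] by_AU) (auto simp: BF_def bounding_factor_def)
  next
    case UY
    then show ?thesis by (intro main[of \<delta>] by_UY) (auto simp: BF_def bounding_factor_def)
  next
    case both
    show ?thesis
    proof (rule main)
      show "\<gamma> * \<delta> / (\<gamma> + \<delta> - 1) > 0" using both by simp
      show "BF S c = ereal (\<gamma> * \<delta> / (\<gamma> + \<delta> - 1))"
        using both by (simp add: BF_def bounding_factor_def one_ereal_def)
      fix m assume m: "m \<in> mediator_support S c"
      have "(\<gamma> + \<delta> - 1) * E True m \<le> \<gamma> * \<delta> * E False m"
        unfolding E_def
        by (rule tilted_mean_bound)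
          (use both m RR_AU_tilt RR_UY_ratio confounder_prob_nonneg confounder_prob_sum in auto)
      then show "E True m \<le> \<gamma> * \<delta> / (\<gamma> + \<delta> - 1) * E False m"
        using both by (simp add: field_simps)
    qed
  qed
qed

lemma NDE_bound: "ereal (NDE_obs S c) / BF S c \<le> ereal (NDE_true S c)"
proof (cases "BF S c = \<infinity>")
  case True
  have "0 \<le> NDE_true S c" by (simp add: NDE_true_def nested_risk_def cond_prob_def)
  with True show ?thesis by simp
next
  case False
  then obtain b where b: "b > 0" "BF S c = ereal b"
    and le: "standardized_risk S c True False \<le> b * nested_risk S c True False"
    using standardized_risk_le by blast
  have "nested_risk S c False False > 0" using reg by (simp add: regularity_def)
  then have "NDE_obs S c \<le> b * NDE_true S c"
    using le by (simp add: NDE_obs_def NDE_true_def standardized_risk_unexposed divide_right_mono)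
  then show ?thesis using b by (simp add: field_simps)
qed

end

section \<open>A model attaining the bound\<close>

text \<open>
  The sample points \<open>n < 12\<close> encode three independent variables: \<open>U = n mod 3\<close>, a coin \<open>B\<close> which
  is \<open>True\<close> if \<open>n div 3\<close> is even and has probability \<open>q\<close>, and the fair exposure \<open>A \<longleftrightarrow> n < 6\<close>.
  The weight below is that of the pair \<open>(U, B)\<close>, which is encoded by \<open>n mod 6\<close>.
  In terms of the sensitivity parameters, \<open>p = 1 / (\<gamma> + 1)\<close> and \<open>q = 1 / \<delta>\<close>.
\<close>
definition sharp_weight :: "real \<Rightarrow> real \<Rightarrow> nat \<Rightarrow> real" where
  "sharp_weight p q n = (if even (n div 3) then q else 1 - q) * (if n mod 3 = 2 then 1 - 2 * p else p)"

definition sharp_pot_mediator :: "bool \<Rightarrow> nat \<Rightarrow> nat" where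
  "sharp_pot_mediator a n = (if a then n mod 3 else min 1 (n mod 3))"

text \<open>
  \<open>Y\<^sub>1\<^sub>1\<close> is certain for \<open>U = 1\<close> and otherwise equals the coin \<open>B\<close>, so that its risks have ratio
  \<open>1 / q = \<delta>\<close>. All other \<open>Y\<^sub>1\<^sub>m\<close> vanish, and \<open>Y\<^sub>0\<^sub>m = 1\<close> makes the denominators of the effects \<open>1\<close>.
\<close>
definition sharp_pot_outcome :: "bool \<Rightarrow> nat \<Rightarrow> nat \<Rightarrow> bool" where
  "sharp_pot_outcome a m n \<longleftrightarrow> (a \<longrightarrow> m = 1 \<and> (n mod 3 = 1 \<or> even (n div 3)))"

definition sharp_model :: "'c \<Rightarrow> real \<Rightarrow> real \<Rightarrow> (nat, nat, 'c, nat) mediation" where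
  "sharp_model c p q = \<lparr>
     law = point_measure {..<12} (\<lambda>n. ennreal (sharp_weight p q n / 2)),
     exposure = (\<lambda>n. n < 6),
     outcome = (\<lambda>n. sharp_pot_outcome (n < 6) (sharp_pot_mediator (n < 6) n) n),
     mediator = (\<lambda>n. sharp_pot_mediator (n < 6) n),
     covariate = (\<lambda>_. c),
     confounder = (\<lambda>n. n mod 3),
     pot_outcome = (\<lambda>a n. sharp_pot_outcome a (sharp_pot_mediator a n) n),
     pot_mediator = sharp_pot_mediator,
     joint_pot_outcome = sharp_pot_outcome\<rparr>"

lemma sharp_model_simps [simp]:
  "exposure (sharp_model c p q) = (\<lambda>n. n < 6)"
  "outcome (sharp_model c p q) = (\<lambda>n. sharp_pot_outcome (n < 6) (sharp_pot_mediator (n < 6) n) n)"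
  "mediator (sharp_model c p q) = (\<lambda>n. sharp_pot_mediator (n < 6) n)"
  "covariate (sharp_model c p q) = (\<lambda>_. c)"
  "confounder (sharp_model c p q) = (\<lambda>n. n mod 3)"
  "pot_outcome (sharp_model c p q) = (\<lambda>a n. sharp_pot_outcome a (sharp_pot_mediator a n) n)"
  "pot_mediator (sharp_model c p q) = sharp_pot_mediator"
  "joint_pot_outcome (sharp_model c p q) = sharp_pot_outcome"
  "space (law (sharp_model c p q)) = {..<12}"
  by (simp_all add: sharp_model_def space_point_measure)

lemma simple_function_sharp [simp]: "simple_function (law (sharp_model c p q)) f"
  by (simp add: sharp_model_def simple_function_def space_point_measure sets_point_measure)

lemma nested_outcome_sharp:
  "nested_outcome (sharp_model c p q) a a' n \<longleftrightarrow> sharp_pot_outcome a (sharp_pot_mediator a' n) n"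
  by (simp add: nested_outcome_def)

text \<open>
  Adding 6 flips the exposure and changes neither \<open>U\<close> nor \<open>B\<close>, so an event is independent of the
  exposure as soon as it is periodic with period 6.
\<close>
lemma add_6_sharp [simp]:
  "(n + 6) mod 3 = n mod (3 :: nat)" "even ((n + 6) div 3) \<longleftrightarrow> even (n div (3 :: nat))"
  "sharp_pot_mediator a (n + 6) = sharp_pot_mediator a n"
  "sharp_pot_outcome a m (n + 6) \<longleftrightarrow> sharp_pot_outcome a m n"
  "sharp_weight p q (n + 6) = sharp_weight p q n"
proof -
  show 1: "(n + 6) mod 3 = n mod (3 :: nat)" "even ((n + 6) div 3) \<longleftrightarrow> even (n div (3 :: nat))"
    by presburger+
  show
    "sharp_pot_mediator a (n + 6) = sharp_pot_mediator a n"
    "sharp_pot_outcome a m (n + 6) \<longleftrightarrow> sharp_pot_outcome a m n"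
    "sharp_weight p q (n + 6) = sharp_weight p q n"
    unfolding sharp_pot_mediator_def sharp_pot_outcome_def sharp_weight_def 1 by simp_all
qed

lemma lessThan_6: "{..<6} = {0, 1, 2, 3, 4, 5 :: nat}"
  by (simp add: eval_nat_numeral lessThan_Suc insert_commute)

context
  fixes c :: 'c and p q :: real
  assumes p: "0 < p" "p \<le> 1 / 2" and q: "0 < q" "q \<le> 1"
begin

lemma sharp_weight_nonneg: "0 \<le> sharp_weight p q n"
  using p q by (auto simp: sharp_weight_def)

lemma measure_sharp:
  "\<P>(n in law (sharp_model c p q). Q n) = (\<Sum>n<12. if Q n then sharp_weight p q n / 2 else 0)"
proof -
  have "\<P>(n in law (sharp_model c p q). Q n) = (\<Sum>n | n < 12 \<and> Q n. sharp_weight p q n / 2)"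
    using measure_point_measure_finite_if[of "{..<12}" "\<lambda>n. sharp_weight p q n / 2" "{n. n < 12 \<and> Q n}"] 
    by (simp add: sharp_weight_nonneg) (simp add: sharp_model_def subset_eq)
  also have "\<dots> = (\<Sum>n<12. if Q n then sharp_weight p q n / 2 else 0)"
    by (rule sum.mono_neutral_cong_left) auto
  finally show ?thesis .
qed

lemma measure_sharp_period:
  assumes R: "\<And>n. R (n + 6) \<longleftrightarrow> R n"
  shows "\<P>(n in law (sharp_model c p q). R n) = (\<Sum>n<6. if R n then sharp_weight p q n else 0)"
    and "\<P>(n in law (sharp_model c p q). (n < 6) = a \<and> R n) = (\<Sum>n<6. if R n then sharp_weight p q n else 0) / 2"
proof -
  let ?f = "\<lambda>n. if R n then sharp_weight p q n else 0"
  \<comment> \<open>the two halves of the sample space are the two exposure groups\<close>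
  have split: "(\<Sum>n<12. h n) = (\<Sum>n<6. h n) + (\<Sum>n<6. h (n + 6))" for h :: "nat \<Rightarrow> real"
  proof -
    have "(\<Sum>n<12. h n) = (\<Sum>n<6. h n) + (\<Sum>n=6..<12. h n)"
      by (simp add: sum.atLeastLessThan_concat lessThan_atLeast0)
    also have "(\<Sum>n=6..<12. h n) = (\<Sum>n<6. h (n + 6))"
      using sum.shift_bounds_nat_ivl[of h 0 6 6] by (simp add: lessThan_atLeast0)
    finally show ?thesis .
  qed
  have half: "(\<Sum>n<6. if R n then sharp_weight p q n / 2 else 0) = (\<Sum>n<6. ?f n) / 2"
    unfolding sum_divide_distrib by (rule sum.cong) auto
  show "\<P>(n in law (sharp_model c p q). R n) = (\<Sum>n<6. ?f n)"
    unfolding measure_sharp split R add_6_sharp half by simp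
  show "\<P>(n in law (sharp_model c p q). (n < 6) = a \<and> R n) = (\<Sum>n<6. ?f n) / 2"
    unfolding measure_sharp split R add_6_sharp half[symmetric]
    by (cases a) (auto intro!: sum.cong sum.neutral)
qed

lemma prob_space_sharp: "prob_space (law (sharp_model c p q))"
proof -
  have "measure (law (sharp_model c p q)) (space (law (sharp_model c p q))) = 1"
    using measure_sharp_period(1)[of "\<lambda>_. True"]
    by (simp add: lessThan_6 sharp_weight_def algebra_simps flip: lessThan_def)
  moreover have "(\<Sum>n<12. sharp_weight p q n / 2) = 
     measure (law (sharp_model c p q)) (space (law (sharp_model c p q)))"
    using measure_sharp[of "\<lambda>_. True"] by (simp flip: lessThan_def)
  ultimately show ?thesis
    unfolding sharp_model_def mediation.simps
    by (intro prob_space_point_measure) (auto simp: sharp_weight_nonneg)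
qed

lemma mediation_model_sharp: "mediation_model (sharp_model c p q)"
  by (auto simp: mediation_model_def nested_outcome_sharp prob_space_sharp)

lemma measure_confounder_sharp:
  "\<P>(n in law (sharp_model c p q). n mod 3 = u) =
     (if u = 0 \<or> u = 1 then p else if u = 2 then 1 - 2 * p else 0)"
proof -
  have u: "u = 0 \<or> u = 1 \<or> u = 2 \<or> u > 2" by linarith
  show ?thesis
    unfolding measure_sharp_period(1)[of "\<lambda>n. n mod 3 = u", OF add_6_sharp(1)[THEN arg_cong]] lessThan_6
    using u by (elim disjE; simp add: sharp_weight_def algebra_simps)
qed

lemma independence_sharp: "independence_assumptions (sharp_model c p q)"
proof -
  let ?P = "law (sharp_model c p q)"
  have M: "cond_indep ?P (sharp_pot_outcome a m) (\<lambda>n. sharp_pot_mediator (n < 6) n) (\<lambda>n. (n < 6, c, n mod 3))" for a m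
    by (rule cond_indep_determined(2)[where h="\<lambda>(a, _, u). sharp_pot_mediator a u"])
      (simp add: sharp_pot_mediator_def)
  have Ma: "cond_indep ?P (sharp_pot_mediator a) Z (\<lambda>n. (c, n mod 3))"
    "cond_indep ?P Z (sharp_pot_mediator a) (\<lambda>n. (c, n mod 3))" for a and Z :: "nat \<Rightarrow> bool"
    by (rule cond_indep_determined[where h="\<lambda>(_, u). sharp_pot_mediator a u"],
      simp add: sharp_pot_mediator_def)+
  have A: "\<P>(n in ?P. (n < 6) = a \<and> R n) = \<P>(n in ?P. R n) / 2"
    if "\<And>n. R (n + 6) \<longleftrightarrow> R n" for a R
    using measure_sharp_period[of R, OF that] by simp
  have AU: "cond_indep ?P (\<lambda>n. n < 6) (\<lambda>n. n mod 3) (\<lambda>_. c)"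
  proof (rule cond_indepI)
    fix x :: bool and u :: nat and w
    show "\<P>(n in ?P. (n < 6) = x \<and> n mod 3 = u \<and> c = w) * \<P>(n in ?P. c = w) =
      \<P>(n in ?P. (n < 6) = x \<and> c = w) * \<P>(n in ?P. n mod 3 = u \<and> c = w)"
      by (subst (1 2) A) simp_all
  qed
  have YA: "cond_indep ?P (sharp_pot_outcome a m) (\<lambda>n. n < 6) (\<lambda>n. (c, n mod 3))" for a m
  proof (rule cond_indepI)
    fix y x :: bool and w
    have "\<P>(n in ?P. sharp_pot_outcome a m n = y \<and> (n < 6) = x \<and> (c, n mod 3) = w) =
       \<P>(n in ?P. (n < 6) = x \<and> sharp_pot_outcome a m n = y \<and> (c, n mod 3) = w)"
      by (simp only: conj_left_commute)
    also have "\<dots> = \<P>(n in ?P. sharp_pot_outcome a m n = y \<and> (c, n mod 3) = w) / 2"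
      by (rule A) simp
    finally have yxR: "\<P>(n in ?P. sharp_pot_outcome a m n = y \<and> (n < 6) = x \<and> (c, n mod 3) = w) = \<dots>" .
    have xR: "\<P>(n in ?P. (n < 6) = x \<and> (c, n mod 3) = w) = \<P>(n in ?P. (c, n mod 3) = w) / 2"
      by (rule A) simp
    show "\<P>(n in ?P. sharp_pot_outcome a m n = y \<and> (n < 6) = x \<and> (c, n mod 3) = w) * \<P>(n in ?P. (c, n mod 3) = w) =
      \<P>(n in ?P. sharp_pot_outcome a m n = y \<and> (c, n mod 3) = w) * \<P>(n in ?P. (n < 6) = x \<and> (c, n mod 3) = w)"
      unfolding yxR xR by simp
  qed
  show ?thesis
    unfolding independence_assumptions_def sharp_model_simps using M Ma AU YA by blast
qed

interpretation sharp: unconfounded_mediation "sharp_model c p q" c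
proof (unfold_locales, rule mediation_model_sharp, rule independence_sharp)
  interpret prob_space "law (sharp_model c p q)" by (rule prob_space_sharp)
  show C: "\<P>(n in law (sharp_model c p q). covariate (sharp_model c p q) n = c) > 0"
    using prob_space by (simp flip: lessThan_def)
  show "\<P>(n in law (sharp_model c p q). exposure (sharp_model c p q) n = a \<bar> covariate (sharp_model c p q) n = c) > 0" for a
  proof -
    have "\<P>(n in law (sharp_model c p q). (n < 6) = a \<and> True) = \<P>(n in law (sharp_model c p q). True) / 2"
      using measure_sharp_period(1)[of "\<lambda>_. True"] measure_sharp_period(2)[of "\<lambda>_. True" a] by simp
    then show ?thesis using C by (simp add: cond_prob_def)
  qed
qed

text \<open>
  The value 2 has probability zero exactly for \<open>p = 1 / 2\<close>, that is, for \<open>\<gamma> = 1\<close>. The value 0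
  then keeps a second stratum in which \<open>Y\<^sub>1\<^sub>1\<close> has the smaller risk \<open>q\<close>.
\<close>
lemma confounder_support_sharp:
  "confounder_support (sharp_model c p q) c = (if 2 * p < 1 then {0, 1, 2} else {0, 1})"
proof (rule set_eqI)
  fix u
  have "u \<in> confounder_support (sharp_model c p q) c \<longleftrightarrow> \<P>(n in law (sharp_model c p q). n mod 3 = u) > 0"
    by (simp add: sharp.confounder_support_iff)
  also have "\<dots> \<longleftrightarrow> u = 0 \<or> u = 1 \<or> u = 2 \<and> 2 * p < 1"
    unfolding measure_confounder_sharp using p(1) by simp
  finally show "u \<in> confounder_support (sharp_model c p q) c \<longleftrightarrow> u \<in> (if 2 * p < 1 then {0, 1, 2} else {0, 1})"
    by simp
qed

lemma pot_mediator_mass_sharp: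
  "sharp.pot_mediator_mass a m u =
    (if sharp_pot_mediator a u = m then if u = 0 \<or> u = 1 then p else if u = 2 then 1 - 2 * p else 0 else 0)"
proof -
  have "{n \<in> space (law (sharp_model c p q)). sharp_pot_mediator a n = m \<and> n mod 3 = u} =
    (if sharp_pot_mediator a u = m then {n \<in> space (law (sharp_model c p q)). n mod 3 = u} else {})"
    by (auto simp: sharp_pot_mediator_def)
  then have "sharp.pot_mediator_mass a m u =
    measure (law (sharp_model c p q)) (if sharp_pot_mediator a u = m then {n \<in> space (law (sharp_model c p q)). n mod 3 = u} else {})"
    unfolding sharp.pot_mediator_mass_def by simp
  then show ?thesis
    using measure_confounder_sharp[of u] by (cases "sharp_pot_mediator a u = m") simp_all
qed

lemma pot_risk_sharp:
  assumes "u \<in> confounder_support (sharp_model c p q) c"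
  shows "sharp.pot_risk a m u = (if a then if m = 1 then if u = 1 then 1 else q else 0 else 1)"
proof -
  have u: "u = 0 \<or> u = 1 \<or> u = 2 \<and> 2 * p < 1"
    using assms p by (auto simp: confounder_support_sharp split: if_splits)
  have "\<P>(n in law (sharp_model c p q). sharp_pot_outcome a m n \<and> n mod 3 = u) =
    (if a then if m = 1 then if u = 1 then 1 else q else 0 else 1) * \<P>(n in law (sharp_model c p q). n mod 3 = u)"
  proof -
    have "\<P>(n in law (sharp_model c p q). sharp_pot_outcome a m n \<and> n mod 3 = u) =
      (\<Sum>n<6. if sharp_pot_outcome a m n \<and> n mod 3 = u then sharp_weight p q n else 0)"
      by (rule measure_sharp_period(1)) simp
    then show ?thesis
      unfolding measure_confounder_sharp lessThan_6 sharp_pot_outcome_def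
      using u by (elim disjE; cases a; cases "m = 1"; simp add: sharp_weight_def algebra_simps)
  qed
  moreover have "\<P>(n in law (sharp_model c p q). n mod 3 = u) > 0"
    using assms by (simp add: sharp.confounder_support_iff)
  ultimately show ?thesis
    by (simp add: sharp.pot_risk_def cond_prob_def)
qed

lemma mediator_prob_sharp:
  "mediator_prob (sharp_model c p q) c False m = (if m = 0 then p else if m = 1 then 1 - p else 0)"
  "mediator_prob (sharp_model c p q) c True m =
    (if m = 0 \<or> m = 1 then p else if m = 2 then 1 - 2 * p else 0)"
proof -
  have "sharp.prob {n. n < 12} = 1"
    using sharp.prob_space by (simp flip: lessThan_def)
  then show
    "mediator_prob (sharp_model c p q) c False m = (if m = 0 then p else if m = 1 then 1 - p else 0)"
    "mediator_prob (sharp_model c p q) c True m = (if m = 0 \<or> m = 1 then p else if m = 2 then 1 - 2 * p else 0)"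
    using p
    by (auto simp: sharp.mediator_prob_eq confounder_support_sharp pot_mediator_mass_sharp sharp_pot_mediator_def)
qed

lemma mediator_support_sharp: "mediator_support (sharp_model c p q) c = {0, 1}"
  using p by (auto simp: mediator_support_def mediator_prob_sharp)

lemma confounder_prob_sharp:
  assumes "u \<in> confounder_support (sharp_model c p q) c"
  shows
  "confounder_prob (sharp_model c p q) c True 0 u = (if u = 0 then 1 else 0)"
  "confounder_prob (sharp_model c p q) c False 0 u = (if u = 0 then 1 else 0)"
  "confounder_prob (sharp_model c p q) c True (Suc 0) u = (if u = 1 then 1 else 0)"
  "confounder_prob (sharp_model c p q) c False (Suc 0) u =
     (if u = 1 then p / (1 - p) else if u = 2 then (1 - 2 * p) / (1 - p) else 0)"
  using p assms unfolding sharp.confounder_prob_eq[OF assms]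
  by (auto simp: confounder_support_sharp pot_mediator_mass_sharp sharp_pot_mediator_def)

lemma nested_risk_sharp:
  "nested_risk (sharp_model c p q) c True False = p + q * (1 - 2 * p)"
  "nested_risk (sharp_model c p q) c False False = 1"
  using p by (auto simp: sharp.nested_risk_eq mediator_support_sharp confounder_support_sharp
      pot_risk_sharp confounder_prob_sharp mediator_prob_sharp divide_simps)

lemma standardized_risk_sharp:
  "standardized_risk (sharp_model c p q) c True False = 1 - p"
  "standardized_risk (sharp_model c p q) c False False = 1"
  using p by (auto simp: sharp.standardized_risk_eq mediator_support_sharp confounder_support_sharp
      pot_risk_sharp confounder_prob_sharp mediator_prob_sharp divide_simps)

lemma regularity_sharp: "regularity (sharp_model c p q) c"
  using p sharp.covariate_pos sharp.exposure_pos
  by (auto simp: regularity_def mediator_prob_sharp nested_risk_sharp standardized_risk_sharp)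

lemma RR_UY_sharp: "RR_UY (sharp_model c p q) c = ereal (1 / q)"
proof -
  let ?V = "confounder_support (sharp_model c p q) c"
  have V: "0 \<in> ?V" "1 \<in> ?V" by (auto simp: confounder_support_sharp)
  have 0: "outcome_risk (sharp_model c p q) c True 0 ` ?V = {0}"
    using V by (auto simp: sharp.outcome_risk_eq_pot_risk pot_risk_sharp image_iff)
  have 1: "outcome_risk (sharp_model c p q) c True 1 ` ?V = {q, 1}"
    using V by (force simp: sharp.outcome_risk_eq_pot_risk pot_risk_sharp image_iff)
  show ?thesis
    using q by (simp add: RR_UY_def mediator_support_sharp 0 1[simplified] max_def min_def one_ereal_def)
qed

lemma RR_AU_sharp: "RR_AU (sharp_model c p q) c = ereal ((1 - p) / p)"
proof -
  let ?w = "confounder_prob (sharp_model c p q) c"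
  let ?D = "\<lambda>m. {u \<in> confounder_support (sharp_model c p q) c. \<not> (?w True m u = 0 \<and> ?w False m u = 0)}"
  have D0: "?D 0 = {0}"
    by (auto simp: confounder_prob_sharp confounder_support_sharp split: if_splits)
  have D1: "?D (Suc 0) = (if 2 * p < 1 then {1, 2} else {1})"
    using p by (auto simp: confounder_prob_sharp confounder_support_sharp split: if_splits)
  have supp: "0 \<in> confounder_support (sharp_model c p q) c" "1 \<in> confounder_support (sharp_model c p q) c"
    "2 * p < 1 \<Longrightarrow> 2 \<in> confounder_support (sharp_model c p q) c"
    by (simp_all add: confounder_support_sharp)
  have ge: "1 \<le> (1 - p) / p" using p by simp
  then have pos: "\<not> (1 - p) / p \<le> 0" by linarith
  \<comment> \<open>at \<open>m = 1\<close> the exposed all lie in stratum 1, which holds \<open>p / (1 - p)\<close> of the unexposed\<close>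
  have R1: "Max ((\<lambda>u. ereal (?w True (Suc 0) u) / ereal (?w False (Suc 0) u)) ` ?D (Suc 0)) = ereal ((1 - p) / p)"
  proof (cases "2 * p < 1")
    case True
    then show ?thesis
      unfolding D1 using supp p pos by (simp add: confounder_prob_sharp max_def)
  next
    case False
    then show ?thesis
      unfolding D1 using supp p by (simp add: confounder_prob_sharp)
  qed
  have R0: "Max ((\<lambda>u. ereal (?w True 0 u) / ereal (?w False 0 u)) ` ?D 0) = 1"
    unfolding D0 using supp by (simp add: confounder_prob_sharp one_ereal_def)
  have "RR_AU (sharp_model c p q) c = max 1 (ereal ((1 - p) / p))"
    unfolding RR_AU_def mediator_support_sharp using R0 R1 by simp
  also have "\<dots> = ereal ((1 - p) / p)"
    using ge by (simp add: max_def one_ereal_def)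
  finally show ?thesis .
qed

lemma NDE_sharp:
  "NDE_true (sharp_model c p q) c = p + q * (1 - 2 * p)"
  "NDE_obs (sharp_model c p q) c = 1 - p"
  by (simp_all add: NDE_true_def NDE_obs_def nested_risk_sharp standardized_risk_sharp)

end

theorem theorem1:
  fixes c :: 'c
  shows
    "(\<forall>S :: ('w, 'm, 'c, 'u) mediation.
        mediation_model S \<and> independence_assumptions S \<and> regularity S c \<longrightarrow>
        ereal (NDE_true S c) \<ge> ereal (NDE_obs S c) / BF S c) \<and>
     (\<forall>\<gamma> \<delta> :: real. \<gamma> \<ge> 1 \<and> \<delta> \<ge> 1 \<longrightarrow>
        (\<exists>S :: (nat, nat, 'c, nat) mediation.
           mediation_model S \<and> independence_assumptions S \<and> regularity S c \<and>
           RR_AU S c = ereal \<gamma> \<and> RR_UY S c = ereal \<delta> \<and>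
           ereal (NDE_true S c) = ereal (NDE_obs S c) / BF S c))"
proof (intro conjI allI impI)
  fix S :: "('w, 'm, 'c, 'u) mediation"
  assume "mediation_model S \<and> independence_assumptions S \<and> regularity S c"
  then interpret regular_mediation S c by unfold_locales (auto simp: regularity_def)
  show "ereal (NDE_true S c) \<ge> ereal (NDE_obs S c) / BF S c" by (rule NDE_bound)
next
  fix \<gamma> \<delta> :: real assume *: "\<gamma> \<ge> 1 \<and> \<delta> \<ge> 1"
  define p q where "p = 1 / (\<gamma> + 1)" and "q = 1 / \<delta>"
  have pq: "0 < p" "p \<le> 1 / 2" "0 < q" "q \<le> 1"
    using * by (auto simp: p_def q_def field_simps)
  have AU: "RR_AU (sharp_model c p q) c = ereal \<gamma>"
    unfolding RR_AU_sharp[OF pq] using * by (simp add: p_def divide_simps)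
  have UY: "RR_UY (sharp_model c p q) c = ereal \<delta>"
    unfolding RR_UY_sharp[OF pq] by (simp add: q_def)
  have "p + q * (1 - 2 * p) = (1 - p) / (\<gamma> * \<delta> / (\<gamma> + \<delta> - 1))"
    using * by (simp add: p_def q_def divide_simps)
  then have "ereal (NDE_true (sharp_model c p q) c) = ereal (NDE_obs (sharp_model c p q) c) / BF (sharp_model c p q) c"
    using * by (simp add: BF_def AU UY bounding_factor_def NDE_sharp[OF pq] one_ereal_def)
  then show "\<exists>S :: (nat, nat, 'c, nat) mediation.
           mediation_model S \<and> independence_assumptions S \<and> regularity S c \<and>
           RR_AU S c = ereal \<gamma> \<and> RR_UY S c = ereal \<delta> \<and>
           ereal (NDE_true S c) = ereal (NDE_obs S c) / BF S c"
    using AU UY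
    by (intro exI[of _ "sharp_model c p q"] conjI mediation_model_sharp[OF pq]
        independence_sharp[OF pq] regularity_sharp[OF pq])
qed

end
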